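(* Let $G$ and $H$ be non-abelian finite groups. If $P_r(G)=P_r(H)$ for infinitely many integers $r\ge 2$ (in particular, if this holds for all sufficiently large $r$), then \[ c_m(G)=c_m(H)\qquad\text{for every }m\ge 2. \] Equivalently, $\mathcal P_G(z)=\mathcal P_H(z)$. Hence the finite abelian-index spectra coincide, and in particular \[ \frac{m(G)}{|G|}=\frac{m(H)}{|H|}, \qquad N_{\max}(G)=N_{\max}(H). \] If moreover $|G|=|H|$, then $m(G)=m(H)$ and $\kappa_r(G)=\kappa_r(H)$ for all $r\ge 1$.
   Context: For a finite group $G$ and $r\ge1$, $\mathrm{Hom}(\mathbb Z^r,G)$ is the set of pairwise commuting $r$-tuples in $G^r$, $P_r(G):=|\mathrm{Hom}(\mathbb Z^r,G)|/|G|^r$, and $\kappa_r(G)$ is the number of orbits of $G$ on $\mathrm{Hom}(\mathbb Z^r,G)$ under diagonal conjugation. $\mathcal P_G(z):=\sum_{r\ge 2}P_r(G)z^{r-2}$. $m(G)$ is the maximum order of an abelian subgroup of $G$; $N_{\max}(G)$ is the number of abelian subgroups of order $m(G)$. For non-abelian $G$ and $m\ge2$, $c_m(G):=-\sum_{A}\mu_2(A,G)$, the sum over all abelian subgroups $A\le G$ with $|G:A|=m$, where $\mu_2$ is the Möbius function of the poset (under inclusion) consisting of all abelian subgroups of $G$ together with $G$ itself. Only finitely many $c_m(G)$ are nonzero, and $P_r(G)=\sum_{m\ge2}c_m(G)m^{-r}$ for all $r\ge2$. The finite abelian-index spectrum of $G$ is the set of pairs $(m,c_m(G))$, $m\ge2$,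 with $c_m(G)\ne0$. *)

theory Defs
  imports
    "HOL-Algebra.Group_Action"
    "HOL-Computational_Algebra.Formal_Power_Series"
begin

definition commuting_tuples :: "('a, 'm) monoid_scheme \<Rightarrow> nat \<Rightarrow> (nat \<Rightarrow> 'a) set" where
  "commuting_tuples G r =
     {x \<in> {..<r} \<rightarrow>\<^sub>E carrier G. \<forall>i<r. \<forall>j<r. x i \<otimes>\<^bsub>G\<^esub> x j = x j \<otimes>\<^bsub>G\<^esub> x i}"

definition commuting_prob :: "('a, 'm) monoid_scheme \<Rightarrow> nat \<Rightarrow> real" where
  "commuting_prob G r = real (card (commuting_tuples G r)) / real (order G) ^ r"

definition diag_conj ::
  "('a, 'm) monoid_scheme \<Rightarrow> nat \<Rightarrow> 'a \<Rightarrow> (nat \<Rightarrow> 'a) \<Rightarrow> (nat \<Rightarrow> 'a)" where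
  "diag_conj G r g =
     (\<lambda>x\<in>commuting_tuples G r. \<lambda>i\<in>{..<r}. g \<otimes>\<^bsub>G\<^esub> x i \<otimes>\<^bsub>G\<^esub> inv\<^bsub>G\<^esub> g)"

definition num_tuple_classes :: "('a, 'm) monoid_scheme \<Rightarrow> nat \<Rightarrow> nat" where
  "num_tuple_classes G r = card (orbits G (commuting_tuples G r) (diag_conj G r))"

definition commuting_series :: "('a, 'm) monoid_scheme \<Rightarrow> real fps" where
  "commuting_series G = Abs_fps (\<lambda>n. commuting_prob G (n + 2))"

definition abelian_subgroups :: "('a, 'm) monoid_scheme \<Rightarrow> 'a set set" where
  "abelian_subgroups G = {A. subgroup A G \<and> comm_group (G\<lparr>carrier := A\<rparr>)}"

definition max_abelian_order :: "('a, 'm) monoid_scheme \<Rightarrow> nat" where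
  "max_abelian_order G = Max (card ` abelian_subgroups G)"

definition num_max_abelian :: "('a, 'm) monoid_scheme \<Rightarrow> nat" where
  "num_max_abelian G = card {A \<in> abelian_subgroups G. card A = max_abelian_order G}"

text \<open>The Moebius function of the finite poset \<open>P\<close> with the order induced from the type;
  the value is \<open>0\<close> unless \<open>x \<le> y\<close> are elements of \<open>P\<close> and \<open>P\<close> is finite.\<close>

function poset_moebius :: "'p::order set \<Rightarrow> 'p \<Rightarrow> 'p \<Rightarrow> int" where
  "poset_moebius P x y =
     (if finite P \<and> x \<in> P \<and> y \<in> P \<and> x \<le> y
      then if x = y then 1 else - (\<Sum>z\<in>{z \<in> P. x \<le> z \<and> z < y}. poset_moebius P x z)
      else 0)"
  by pat_completeness auto
termination
proof (relation "measure (\<lambda>(P, x, y). card {z \<in> P. z < y})", goal_cases)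
  case 1
  show ?case by simp
next
  case (2 P x y z)
  then have "{w \<in> P. w < z} \<subset> {w \<in> P. w < y}"
    by auto
  with 2 show ?case
    by (simp add: psubset_card_mono)
qed

declare poset_moebius.simps [simp del]

definition abelian_poset :: "('a, 'm) monoid_scheme \<Rightarrow> 'a set set" where
  "abelian_poset G = insert (carrier G) (abelian_subgroups G)"

definition abelian_index_coeff :: "('a, 'm) monoid_scheme \<Rightarrow> nat \<Rightarrow> int" where
  "abelian_index_coeff G m =
     - (\<Sum>A\<in>{A \<in> abelian_subgroups G. card (rcosets\<^bsub>G\<^esub> A) = m}.
          poset_moebius (abelian_poset G) A (carrier G))"

definition abelian_index_spectrum :: "('a, 'm) monoid_scheme \<Rightarrow> (nat \<times> int) set" where
  "abelian_index_spectrum G =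
     {(m, abelian_index_coeff G m) | m. m \<ge> 2 \<and> abelian_index_coeff G m \<noteq> 0}"

end

theory Submission
  imports Defs "HOL-Algebra.Generated_Groups"
begin

text \<open>Moebius inversion, applied to the subgroup generated by a commuting tuple, gives
  \<open>P\<^sub>r(G) = \<Sum>\<^sub>m c\<^sub>m(G) m\<^sup>-\<^sup>r\<close>.  A finite sum of this shape that vanishes for infinitely many
  \<open>r\<close> has only zero coefficients, since after multiplication by \<open>k\<^sup>r\<close> it tends to the coefficient of
  the least index \<open>k\<close> that occurs.  The least \<open>m\<close> with \<open>c\<^sub>m(G) \<noteq> 0\<close> is \<open>|G| / m(G)\<close>, with
  coefficient \<open>N\<^sub>m\<^sub>a\<^sub>x(G)\<close>, because \<open>\<mu>(A, G) = -1\<close> for an abelian subgroup \<open>A\<close> of maximal order.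
  Burnside's lemma gives \<open>\<kappa>\<^sub>r(G) = |G|\<^sup>r P\<^sub>r\<^sub>+\<^sub>1(G)\<close>.\<close>

section \<open>The Moebius function of a finite poset\<close>

lemma poset_moebius_refl:
  assumes "finite P" "x \<in> P"
  shows "poset_moebius P x x = 1"
  using assms by (subst poset_moebius.simps) simp

text \<open>This is the recursion defining \<open>poset_moebius\<close> with its left side moved
  under the sum: \<open>y\<close> is the only element of the closed interval that the recursion
  omits.\<close>

lemma sum_poset_moebius_upper:
  assumes P: "finite P" and x: "x \<in> P" and y: "y \<in> P" and le: "x \<le> y"
  shows "(\<Sum>z\<in>{z \<in> P. x \<le> z \<and> z \<le> y}. poset_moebius P x z) = (if x = y then 1 else 0)"
proof (cases "x = y")
  case True
  then have "{z \<in> P. x \<le> z \<and> z \<le> y} = {x}"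
    using x by auto
  then show ?thesis
    using True poset_moebius_refl[OF P x] by simp
next
  case False
  have "{z \<in> P. x \<le> z \<and> z \<le> y} = insert y {z \<in> P. x \<le> z \<and> z < y}"
    using y le by auto
  then have "(\<Sum>z\<in>{z \<in> P. x \<le> z \<and> z \<le> y}. poset_moebius P x z) =
      poset_moebius P x y + (\<Sum>z\<in>{z \<in> P. x \<le> z \<and> z < y}. poset_moebius P x z)"
    using P by simp
  also have "poset_moebius P x y = - (\<Sum>z\<in>{z \<in> P. x \<le> z \<and> z < y}. poset_moebius P x z)"
    using assms False by (subst poset_moebius.simps) simp
  finally show ?thesis
    using False by simp
qed

text \<open>In the incidence algebra the recursion for \<open>\<mu>\<close> says \<open>\<mu> * \<zeta> = \<delta>\<close>.  The other identity
  \<open>\<zeta> * \<mu> = \<delta>\<close> follows from \<open>\<mu> * (\<zeta> * \<mu>) = \<mu>\<close> by downward induction on \<open>x\<close>.\<close>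

lemma sum_poset_moebius_lower:
  assumes P: "finite P" and y: "y \<in> P" and "x \<in> P" and "x \<le> y"
  shows "(\<Sum>z\<in>{z \<in> P. x \<le> z \<and> z \<le> y}. poset_moebius P z y) = (if x = y then 1 else 0)"
  using assms(3,4)
proof (induction "card {z \<in> P. x < z}" arbitrary: x rule: less_induct)
  case less
  let ?m = "poset_moebius P"
  let ?I = "\<lambda>u v. {z \<in> P. u \<le> z \<and> z \<le> v}"
  let ?g = "\<lambda>u. \<Sum>z\<in>?I u y. ?m z y"
  have fin: "finite (?I u v)" for u v
    using P by simp
  have IH: "?g z = (if z = y then 1 else 0)" if "z \<in> P" "x < z" "z \<le> y" for z
  proof (rule less.hyps)
    have "{w \<in> P. z < w} \<subset> {w \<in> P. x < w}"
      using that by auto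
    then show "card {w \<in> P. z < w} < card {w \<in> P. x < w}"
      using P by (simp add: psubset_card_mono)
  qed (use that in auto)
  \<comment> \<open>The double sum runs over chains \<open>x \<le> z \<le> w \<le> y\<close>.
    Summing over \<open>z\<close> first makes the inner sum an instance of
    \<open>sum_poset_moebius_upper\<close>, which leaves only \<open>w = x\<close>.\<close>
  have "(\<Sum>z\<in>?I x y. ?m x z * ?g z) = (\<Sum>z\<in>?I x y. \<Sum>w\<in>{w \<in> ?I x y. z \<le> w}. ?m x z * ?m w y)"
    unfolding sum_distrib_left by (intro sum.cong refl) auto
  also have "\<dots> = (\<Sum>w\<in>?I x y. \<Sum>z\<in>{z \<in> ?I x y. z \<le> w}. ?m x z * ?m w y)"
    by (rule sum.swap_restrict) (use fin in auto)
  also have "\<dots> = (\<Sum>w\<in>?I x y. (\<Sum>z\<in>?I x w. ?m x z) * ?m w y)"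
    unfolding sum_distrib_right by (intro sum.cong refl) auto
  also have "\<dots> = (\<Sum>w\<in>?I x y. if x = w then ?m w y else 0)"
    using P less.prems by (intro sum.cong refl) (simp add: sum_poset_moebius_upper)
  also have "\<dots> = ?m x y"
    using fin less.prems by simp
  finally have conv: "(\<Sum>z\<in>?I x y. ?m x z * ?g z) = ?m x y" .
  \<comment> \<open>The same sum is evaluated a second time: the induction hypothesis covers every
    \<open>z\<close> except \<open>x\<close> and keeps only \<open>z = y\<close>. Comparison with
    \<open>conv\<close> then determines \<open>?g x\<close>.\<close>
  have "(\<Sum>z\<in>?I x y. ?m x z * ?g z) = ?m x x * ?g x + (\<Sum>z\<in>?I x y - {x}. ?m x z * ?g z)"
    using fin less.prems by (subst sum.remove[of _ x]) auto
  also have "(\<Sum>z\<in>?I x y - {x}. ?m x z * ?g z) = (\<Sum>z\<in>?I x y - {x}. if z = y then ?m x z else 0)"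
  proof (intro sum.cong refl)
    fix z assume "z \<in> ?I x y - {x}"
    then have "?g z = (if z = y then 1 else 0)"
      by (intro IH) auto
    then show "?m x z * ?g z = (if z = y then ?m x z else 0)"
      by simp
  qed
  also have "\<dots> = (if x = y then 0 else ?m x y)"
    using fin less.prems y by (simp add: sum.delta)
  finally show ?case
    using conv poset_moebius_refl[OF P less.prems(1)] by (auto split: if_splits)
qed

section \<open>Uniqueness of the coefficients of a finite Dirichlet sum\<close>

lemma finite_dirichlet_sum_unique:
  fixes d :: "nat \<Rightarrow> real"
  assumes inf: "infinite {r. (\<Sum>m\<in>{1..N}. d m / real m ^ r) = 0}"
    and m: "m \<in> {1..N}"
  shows "d m = 0"
proof (rule ccontr)
  assume "d m \<noteq> 0"
  define k where "k = (LEAST j. j \<in> {1..N} \<and> d j \<noteq> 0)"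
  have k: "k \<in> {1..N} \<and> d k \<noteq> 0"
    unfolding k_def by (rule LeastI[of _ m]) (use m \<open>d m \<noteq> 0\<close> in auto)
  have below: "d j = 0" if "j \<in> {1..N}" "j < k" for j
    using not_less_Least[of j "\<lambda>j. j \<in> {1..N} \<and> d j \<noteq> 0"] that unfolding k_def by auto
  define f where "f = (\<lambda>r. \<Sum>j\<in>{1..N}. d j * (real k / real j) ^ r)"
  have f_eq: "f r = real k ^ r * (\<Sum>j\<in>{1..N}. d j / real j ^ r)" for r
    unfolding f_def sum_distrib_left by (intro sum.cong refl) (simp add: power_divide)
  have "f \<longlonglongrightarrow> (\<Sum>j\<in>{1..N}. if j = k then d k else 0)"
    unfolding f_def
  proof (intro tendsto_sum)
    fix j assume j: "j \<in> {1..N}"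
    \<comment> \<open>Terms with \<open>j < k\<close> vanish by minimality of \<open>k\<close>;
      those with \<open>j > k\<close> decay geometrically.\<close>
    consider "j < k" | "j = k" | "j > k" by linarith
    then show "(\<lambda>r. d j * (real k / real j) ^ r) \<longlonglongrightarrow> (if j = k then d k else 0)"
    proof cases
      case 3
      then have "norm (real k / real j) < 1"
        by simp
      then have "(\<lambda>r. d j * (real k / real j) ^ r) \<longlonglongrightarrow> d j * 0"
        by (intro tendsto_mult tendsto_const LIMSEQ_power_zero)
      then show ?thesis
        using 3 by simp
    qed (use j k below in auto)
  qed
  then have lim: "f \<longlonglongrightarrow> d k"
    using k by simp
  \<comment> \<open>The limit \<open>d k\<close> is nonzero, so the rescaled sum has no zeros from
    some \<open>R\<close> on, and its zero set would be finite.\<close>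
  have "\<forall>\<^sub>F r in sequentially. f r \<noteq> 0"
    by (rule tendsto_imp_eventually_ne[OF lim]) (use k in simp)
  then obtain R where "\<forall>r\<ge>R. f r \<noteq> 0"
    by (auto simp: eventually_sequentially)
  then have "{r. (\<Sum>m\<in>{1..N}. d m / real m ^ r) = 0} \<subseteq> {..<R}"
    unfolding f_eq by (metis (mono_tags, lifting) lessThan_iff mem_Collect_eq mult_zero_right not_le subsetI)
  with inf show False
    using finite_subset by blast
qed

section \<open>Abelian subgroups and subgroups generated by commuting elements\<close>

lemma abelian_subgroupsD:
  assumes "A \<in> abelian_subgroups G"
  shows "subgroup A G" "\<And>a b. a \<in> A \<Longrightarrow> b \<in> A \<Longrightarrow> a \<otimes>\<^bsub>G\<^esub> b = b \<otimes>\<^bsub>G\<^esub> a" "A \<subseteq> carrier G"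
proof -
  show sub: "subgroup A G"
    using assms by (simp add: abelian_subgroups_def)
  then show "A \<subseteq> carrier G"
    by (rule subgroup.subset)
  interpret A: comm_group "G\<lparr>carrier := A\<rparr>"
    using assms by (simp add: abelian_subgroups_def)
  show "a \<otimes>\<^bsub>G\<^esub> b = b \<otimes>\<^bsub>G\<^esub> a" if "a \<in> A" "b \<in> A" for a b
    using A.m_comm that by simp
qed

lemma finite_abelian_subgroups:
  assumes "finite (carrier G)"
  shows "finite (abelian_subgroups G)"
  by (rule finite_subset[of _ "Pow (carrier G)"]) (use assms abelian_subgroupsD(3) in auto)

lemma finite_commuting_tuples:
  assumes "finite (carrier G)"
  shows "finite (commuting_tuples G r)"
  unfolding commuting_tuples_def using assms by (auto intro!: finite_PiE)

context group
begin

lemma subgroup_centralizer: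
  assumes "S \<subseteq> carrier G"
  shows "subgroup {g \<in> carrier G. \<forall>s\<in>S. g \<otimes> s = s \<otimes> g} G"
proof (rule subgroupI)
  fix g assume g: "g \<in> {g \<in> carrier G. \<forall>s\<in>S. g \<otimes> s = s \<otimes> g}"
  have "inv g \<otimes> s = s \<otimes> inv g" if "s \<in> S" for s
  proof -
    have c: "g \<in> carrier G" "s \<in> carrier G" "g \<otimes> s = s \<otimes> g"
      using g assms that by auto
    \<comment> \<open>\<open>s\<close> equals its conjugate by \<open>g\<close>; moving the leading
      \<open>g\<close> to the other side gives commutation with \<open>inv g\<close>.\<close>
    then have "s = g \<otimes> (s \<otimes> inv g)"
      by (simp add: inv_solve_right m_assoc[symmetric])
    with c show ?thesis
      by (simp add: inv_solve_left')
  qed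
  with g show "inv g \<in> {g \<in> carrier G. \<forall>s\<in>S. g \<otimes> s = s \<otimes> g}"
    by simp
next
  fix g h
  assume "g \<in> {g \<in> carrier G. \<forall>s\<in>S. g \<otimes> s = s \<otimes> g}"
    and "h \<in> {g \<in> carrier G. \<forall>s\<in>S. g \<otimes> s = s \<otimes> g}"
  then show "g \<otimes> h \<in> {g \<in> carrier G. \<forall>s\<in>S. g \<otimes> s = s \<otimes> g}"
    using assms by (auto simp: subset_iff) (metis m_assoc)
next
  have "\<one> \<in> {g \<in> carrier G. \<forall>s\<in>S. g \<otimes> s = s \<otimes> g}"
    using assms by auto
  then show "{g \<in> carrier G. \<forall>s\<in>S. g \<otimes> s = s \<otimes> g} \<noteq> {}"
    by blast
qed auto

text \<open>Two centralizer inclusions replace an induction over words. The centralizer of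
  \<open>S\<close> contains \<open>S\<close>, hence \<open>generate G S\<close>; read the other way,
  \<open>S\<close> lies in the centralizer of \<open>generate G S\<close>, which therefore contains
  \<open>generate G S\<close> as well.\<close>

lemma generate_in_abelian_subgroups:
  assumes S: "S \<subseteq> carrier G" and comm: "\<And>x y. x \<in> S \<Longrightarrow> y \<in> S \<Longrightarrow> x \<otimes> y = y \<otimes> x"
  shows "generate G S \<in> abelian_subgroups G"
proof -
  let ?C = "\<lambda>T. {g \<in> carrier G. \<forall>t\<in>T. g \<otimes> t = t \<otimes> g}"
  have sub: "subgroup (generate G S) G"
    by (rule generate_is_subgroup[OF S])
  then have car: "generate G S \<subseteq> carrier G"
    by (rule subgroup.subset)
  have "generate G S \<subseteq> ?C S"
    by (rule generate_subgroup_incl[OF _ subgroup_centralizer[OF S]]) (use S comm in auto)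
  then have "S \<subseteq> ?C (generate G S)"
    using S by auto
  then have "generate G S \<subseteq> ?C (generate G S)"
    by (rule generate_subgroup_incl[OF _ subgroup_centralizer[OF car]])
  then have "comm_group (G\<lparr>carrier := generate G S\<rparr>)"
    by (intro group.group_comm_groupI subgroup.subgroup_is_group[OF sub] is_group) auto
  with sub show ?thesis
    by (simp add: abelian_subgroups_def)
qed

lemma abelian_subgroups_nonempty: "abelian_subgroups G \<noteq> {}"
  using generate_in_abelian_subgroups[of "{}"] by auto

section \<open>Moebius inversion over the abelian subgroups\<close>

lemma carrier_notin_abelian_subgroups:
  assumes "\<not> comm_group G"
  shows "carrier G \<notin> abelian_subgroups G"
  using assms by (simp add: abelian_subgroups_def)

text \<open>The interval from \<open>B\<close> to the top consists of these \<open>A\<close> and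
  \<open>carrier G\<close>, whose Moebius value is 1. Since \<open>G\<close> is not abelian,
  \<open>B\<close> is not the top, so the whole interval sums to 0.\<close>

lemma sum_moebius_over_abelian_subgroups:
  assumes fin: "finite (carrier G)" and nab: "\<not> comm_group G" and B: "B \<in> abelian_subgroups G"
  shows "(\<Sum>A\<in>{A \<in> abelian_subgroups G. B \<subseteq> A}. poset_moebius (abelian_poset G) A (carrier G)) = -1"
proof -
  let ?P = "abelian_poset G"
  have P: "finite ?P" "carrier G \<in> ?P" "B \<in> ?P" "B \<subseteq> carrier G" "B \<noteq> carrier G"
    using fin B abelian_subgroupsD(3)[OF B] carrier_notin_abelian_subgroups[OF nab]
    by (auto simp: finite_abelian_subgroups abelian_poset_def)
  have "{A \<in> ?P. B \<subseteq> A \<and> A \<subseteq> carrier G} = insert (carrier G) {A \<in> abelian_subgroups G. B \<subseteq> A}"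
    using P abelian_subgroupsD(3) by (auto simp: abelian_poset_def)
  then have "0 = (\<Sum>A\<in>insert (carrier G) {A \<in> abelian_subgroups G. B \<subseteq> A}.
      poset_moebius ?P A (carrier G))"
    using sum_poset_moebius_lower[OF P(1-4)] P(5) by simp
  then show ?thesis
    using P poset_moebius_refl[OF P(1,2)] carrier_notin_abelian_subgroups[OF nab]
      finite_abelian_subgroups[OF fin] by simp
qed

text \<open>Double counting of pairs of a commuting tuple \<open>x\<close> and an abelian subgroup
  \<open>A\<close> containing its entries, each weighted by the Moebius value of \<open>A\<close>.
  For fixed \<open>x\<close> the weights add up to -1; for fixed \<open>A\<close> every
  \<open>r\<close>-tuple in \<open>A\<close> occurs, because \<open>A\<close> is abelian.\<close>

lemma card_commuting_tuples_moebius: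
  assumes fin: "finite (carrier G)" and nab: "\<not> comm_group G"
  shows "int (card (commuting_tuples G r)) =
    - (\<Sum>A\<in>abelian_subgroups G. poset_moebius (abelian_poset G) A (carrier G) * int (card A) ^ r)"
proof -
  let ?T = "commuting_tuples G r" and ?\<A> = "abelian_subgroups G"
  let ?m = "\<lambda>A. poset_moebius (abelian_poset G) A (carrier G)"
  have one: "(\<Sum>A\<in>{A \<in> ?\<A>. x ` {..<r} \<subseteq> A}. ?m A) = -1" if x: "x \<in> ?T" for x
  proof -
    have S: "x ` {..<r} \<subseteq> carrier G"
      using x by (auto simp: commuting_tuples_def)
    have B: "generate G (x ` {..<r}) \<in> ?\<A>"
      using x S by (intro generate_in_abelian_subgroups) (auto simp: commuting_tuples_def)
    \<comment> \<open>A subgroup contains the entries exactly when it contains the subgroup they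
      generate, so the condition becomes an upper set in the poset.\<close>
    have "{A \<in> ?\<A>. x ` {..<r} \<subseteq> A} = {A \<in> ?\<A>. generate G (x ` {..<r}) \<subseteq> A}"
      using generate_subgroup_incl[of "x ` {..<r}"] generate.incl[of _ "x ` {..<r}" G]
        abelian_subgroupsD(1) by blast
    then show ?thesis
      using sum_moebius_over_abelian_subgroups[OF fin nab B] by simp
  qed
  have tuples: "card {x \<in> ?T. x ` {..<r} \<subseteq> A} = card A ^ r" if A: "A \<in> ?\<A>" for A
  proof -
    have "{x \<in> ?T. x ` {..<r} \<subseteq> A} = {..<r} \<rightarrow>\<^sub>E A"
    proof (intro equalityI subsetI)
      fix x assume "x \<in> {x \<in> ?T. x ` {..<r} \<subseteq> A}"
      then show "x \<in> {..<r} \<rightarrow>\<^sub>E A"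
        by (auto simp: commuting_tuples_def PiE_iff)
    next
      fix x assume "x \<in> {..<r} \<rightarrow>\<^sub>E A"
      then have x: "x \<in> extensional {..<r}" "\<And>i. i < r \<Longrightarrow> x i \<in> A"
        by (auto simp: PiE_iff)
      then show "x \<in> {x \<in> ?T. x ` {..<r} \<subseteq> A}"
        using abelian_subgroupsD(2,3)[OF A] by (auto simp: commuting_tuples_def PiE_iff)
    qed
    then show ?thesis
      by (simp add: card_PiE)
  qed
  have "- int (card ?T) = (\<Sum>x\<in>?T. \<Sum>A\<in>{A \<in> ?\<A>. x ` {..<r} \<subseteq> A}. ?m A)"
    by (simp add: one)
  also have "\<dots> = (\<Sum>A\<in>?\<A>. \<Sum>x\<in>{x \<in> ?T. x ` {..<r} \<subseteq> A}. ?m A)"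
    by (rule sum.swap_restrict) (use fin in \<open>auto simp: finite_commuting_tuples finite_abelian_subgroups\<close>)
  also have "\<dots> = (\<Sum>A\<in>?\<A>. ?m A * int (card A) ^ r)"
    by (intro sum.cong refl) (simp add: tuples)
  finally show ?thesis
    by simp
qed

section \<open>Abelian subgroups grouped by index\<close>

lemma abelian_index_bounds:
  assumes fin: "finite (carrier G)" and nab: "\<not> comm_group G" and A: "A \<in> abelian_subgroups G"
  shows "2 \<le> card (rcosets A)" "card (rcosets A) \<le> order G"
proof -
  have lag: "card (rcosets A) * card A = order G"
    using lagrange_finite[OF fin abelian_subgroupsD(1)[OF A]] .
  have pos: "order G > 0"
    using fin order_gt_0_iff_finite by simp
  \<comment> \<open>If \<open>A\<close> were all of \<open>G\<close>, then \<open>G\<close> would be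
    abelian; this rules out index 1.\<close>
  have "card A < order G"
    unfolding order_def using fin abelian_subgroupsD(3)[OF A] A carrier_notin_abelian_subgroups[OF nab]
    by (metis psubset_card_mono psubsetI)
  then have "card (rcosets A) \<noteq> 1" "card (rcosets A) \<noteq> 0"
    using lag pos by (metis mult_1 less_irrefl, metis mult_0 less_irrefl)
  then show "2 \<le> card (rcosets A)"
    by linarith
  show "card (rcosets A) \<le> order G"
    using lag pos by (metis dvd_imp_le dvd_triv_left)
qed

lemma abelian_index_coeff_eq_0:
  assumes "finite (carrier G)" and "\<not> comm_group G" and "m < 2 \<or> m > order G"
  shows "abelian_index_coeff G m = 0"
proof -
  have "{A \<in> abelian_subgroups G. card (rcosets A) = m} = {}"
    using abelian_index_bounds[OF assms(1,2)] assms(3) by fastforce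
  then show ?thesis
    unfolding abelian_index_coeff_def by (simp only: sum.empty minus_zero)
qed

text \<open>By Lagrange \<open>|A| / |G|\<close> is the reciprocal of the index, and the Moebius sum
  is collected by index. The bound \<open>N\<close> stays free so that two groups can share one
  range of summation.\<close>

lemma commuting_prob_eq_sum:
  assumes fin: "finite (carrier G)" and nab: "\<not> comm_group G" and N: "order G \<le> N"
  shows "commuting_prob G r = (\<Sum>m\<in>{1..N}. real_of_int (abelian_index_coeff G m) / real m ^ r)"
proof -
  let ?\<A> = "abelian_subgroups G"
  let ?m = "\<lambda>A. poset_moebius (abelian_poset G) A (carrier G)"
  have finA: "finite ?\<A>"
    by (rule finite_abelian_subgroups[OF fin])
  have quot: "real (card A) / real (order G) = 1 / real (card (rcosets A))" if A: "A \<in> ?\<A>" for A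
  proof -
    have "real (card (rcosets A)) * real (card A) = real (order G)"
      using lagrange_finite[OF fin abelian_subgroupsD(1)[OF A]] by (metis of_nat_mult)
    moreover have "real (order G) > 0"
      using fin order_gt_0_iff_finite by simp
    ultimately show ?thesis
      by (auto simp: divide_simps mult.commute)
  qed
  have "real (card (commuting_tuples G r)) = real_of_int (int (card (commuting_tuples G r)))"
    by simp
  also have "\<dots> = - (\<Sum>A\<in>?\<A>. real_of_int (?m A) * real (card A) ^ r)"
    unfolding card_commuting_tuples_moebius[OF fin nab] by simp
  finally have "commuting_prob G r =
      - (\<Sum>A\<in>?\<A>. real_of_int (?m A) * (real (card A) / real (order G)) ^ r)"
    by (simp add: commuting_prob_def sum_divide_distrib power_divide)
  also have "\<dots> = - (\<Sum>A\<in>?\<A>. real_of_int (?m A) / real (card (rcosets A)) ^ r)"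
    by (simp add: quot power_divide)
  also have "\<dots> = - (\<Sum>m\<in>{1..N}. \<Sum>A\<in>{A \<in> ?\<A>. card (rcosets A) = m}.
      real_of_int (?m A) / real (card (rcosets A)) ^ r)"
  proof (subst sum.group[OF finA])
    show "(\<lambda>A. card (rcosets A)) ` ?\<A> \<subseteq> {1..N}"
      using abelian_index_bounds[OF fin nab] N by fastforce
  qed auto
  also have "\<dots> = (\<Sum>m\<in>{1..N}. real_of_int (abelian_index_coeff G m) / real m ^ r)"
    by (simp add: abelian_index_coeff_def sum_divide_distrib sum_negf)
  finally show ?thesis .
qed

text \<open>By Lagrange the least index belongs to the largest order. A positive coefficient at
  \<open>k\<close> and zeros below it make \<open>k\<close> recoverable from the coefficients
  alone.\<close>

lemma least_abelian_index:
  assumes fin: "finite (carrier G)" and nab: "\<not> comm_group G"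
  obtains k where "k * max_abelian_order G = order G" "k > 0"
    "abelian_index_coeff G k = int (num_max_abelian G)" "num_max_abelian G > 0"
    "\<And>j. j < k \<Longrightarrow> abelian_index_coeff G j = 0"
proof -
  let ?\<A> = "abelian_subgroups G" and ?M = "max_abelian_order G"
  let ?Mx = "{A \<in> ?\<A>. card A = ?M}"
  have finA: "finite ?\<A>"
    by (rule finite_abelian_subgroups[OF fin])
  have "?M \<in> card ` ?\<A>"
    unfolding max_abelian_order_def using finA abelian_subgroups_nonempty by (intro Max_in) auto
  then obtain B where B: "B \<in> ?\<A>" "card B = ?M"
    by auto
  have le: "card A \<le> ?M" if "A \<in> ?\<A>" for A
    unfolding max_abelian_order_def using finA that by simp
  have pos: "order G > 0"
    using fin order_gt_0_iff_finite by simp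
  have lag: "card (rcosets A) * card A = order G" if "A \<in> ?\<A>" for A
    using lagrange_finite[OF fin abelian_subgroupsD(1)[OF that]] .
  define k where "k = card (rcosets B)"
  have kM: "k * ?M = order G"
    using lag[OF B(1)] B(2) by (simp add: k_def)
  have Mpos: "?M > 0" and kpos: "k > 0"
    using kM pos by (metis gr0I mult_0_right less_irrefl, metis gr0I mult_0 less_irrefl)
  have idx: "{A \<in> ?\<A>. card (rcosets A) = k} = ?Mx"
  proof (intro Collect_cong conj_cong refl)
    fix A assume "A \<in> ?\<A>"
    then show "card (rcosets A) = k \<longleftrightarrow> card A = ?M"
      using lag[of A] kM Mpos kpos by (metis mult_cancel1 mult_cancel2 less_irrefl)
  qed
  have mu: "poset_moebius (abelian_poset G) A (carrier G) = -1" if A: "A \<in> ?Mx" for A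
  proof -
    \<comment> \<open>No abelian subgroup lies properly above one of maximal order, so the sum equal
      to -1 has a single term.\<close>
    have "{C \<in> ?\<A>. A \<subseteq> C} = {A}"
    proof (intro equalityI subsetI)
      fix C assume C: "C \<in> {C \<in> ?\<A>. A \<subseteq> C}"
      then have "finite C" "card C \<le> card A"
        using A le[of C] abelian_subgroupsD(3)[of C G] fin finite_subset by auto
      with C show "C \<in> {A}"
        using card_seteq[of C A] by auto
    qed (use A in auto)
    then show ?thesis
      using sum_moebius_over_abelian_subgroups[OF fin nab, of A] A by simp
  qed
  show ?thesis
  proof
    show "abelian_index_coeff G k = int (num_max_abelian G)"
      unfolding abelian_index_coeff_def idx num_max_abelian_def by (simp add: mu)
    show "num_max_abelian G > 0"
      unfolding num_max_abelian_def using finA B by (auto simp: card_gt_0_iff)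
    fix j assume j: "j < k"
    \<comment> \<open>An index below \<open>k\<close> would force an order above the
      maximum.\<close>
    have "card (rcosets A) \<noteq> j" if A: "A \<in> ?\<A>" for A
    proof
      assume "card (rcosets A) = j"
      then have "j * card A = k * ?M"
        using lag[OF A] kM by simp
      moreover have "j * card A \<le> j * ?M"
        using le[OF A] by simp
      moreover have "j * ?M < k * ?M"
        using j Mpos by simp
      ultimately show False
        by linarith
    qed
    then have "{A \<in> ?\<A>. card (rcosets A) = j} = {}"
      by blast
    then show "abelian_index_coeff G j = 0"
      unfolding abelian_index_coeff_def by (simp only: sum.empty minus_zero)
  qed (use kM kpos in auto)
qed

section \<open>Diagonal conjugation and Burnside's lemma\<close>

lemma conj_fixes_iff:
  assumes "g \<in> carrier G" "x \<in> carrier G"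
  shows "g \<otimes> x \<otimes> inv g = x \<longleftrightarrow> g \<otimes> x = x \<otimes> g"
  using assms by (simp add: inv_solve_right')

lemma diag_conj_closed:
  assumes g: "g \<in> carrier G" and x: "x \<in> commuting_tuples G r"
  shows "diag_conj G r g x \<in> commuting_tuples G r"
proof -
  have c: "x i \<in> carrier G" if "i < r" for i
    using x that by (auto simp: commuting_tuples_def)
  \<comment> \<open>Conjugation is multiplicative, so conjugates of commuting entries
    commute.\<close>
  have prod: "(g \<otimes> a \<otimes> inv g) \<otimes> (g \<otimes> b \<otimes> inv g) = g \<otimes> (a \<otimes> b) \<otimes> inv g"
    if "a \<in> carrier G" "b \<in> carrier G" for a b
    using g that by (simp add: m_assoc inv_solve_left')
  show ?thesis
    using g x c by (auto simp: diag_conj_def commuting_tuples_def prod)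
qed

lemma diag_conj_mult:
  assumes g: "g \<in> carrier G" and h: "h \<in> carrier G" and x: "x \<in> commuting_tuples G r"
  shows "diag_conj G r (g \<otimes> h) x = diag_conj G r g (diag_conj G r h x)"
proof -
  have "x i \<in> carrier G" if "i < r" for i
    using x that by (auto simp: commuting_tuples_def)
  then show ?thesis
    using g h x diag_conj_closed[OF h x]
    by (auto simp: diag_conj_def m_assoc inv_mult_group intro!: restrict_ext)
qed

lemma diag_conj_one:
  assumes x: "x \<in> commuting_tuples G r"
  shows "diag_conj G r \<one> x = x"
proof
  fix i
  show "diag_conj G r \<one> x i = x i"
    using x by (cases "i < r") (auto simp: diag_conj_def commuting_tuples_def PiE_iff extensional_def)
qed

lemma diag_conj_Bij:
  assumes g: "g \<in> carrier G"
  shows "diag_conj G r g \<in> Bij (commuting_tuples G r)"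
proof -
  have "bij_betw (diag_conj G r g) (commuting_tuples G r) (commuting_tuples G r)"
    by (rule bij_betw_byWitness[where f' = "diag_conj G r (inv g)"])
      (use g diag_conj_closed in \<open>auto simp: diag_conj_mult[symmetric] diag_conj_one\<close>)
  then show ?thesis
    by (simp add: Bij_def diag_conj_def)
qed

lemma diag_conj_action: "group_action G (commuting_tuples G r) (diag_conj G r)"
proof -
  have "diag_conj G r (g \<otimes> h) = compose (commuting_tuples G r) (diag_conj G r g) (diag_conj G r h)"
    if "g \<in> carrier G" "h \<in> carrier G" for g h
  \<comment> \<open>Both maps are extensional, so they need only be compared on commuting
    tuples.\<close>
  proof (rule extensionalityI[where A = "commuting_tuples G r"])
    show "diag_conj G r (g \<otimes> h) \<in> extensional (commuting_tuples G r)"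
      by (simp add: diag_conj_def)
  qed (use that in \<open>auto simp: compose_def diag_conj_mult\<close>)
  then have "diag_conj G r \<in> hom G (BijGroup (commuting_tuples G r))"
    by (auto simp: hom_def BijGroup_def diag_conj_Bij)
  then show ?thesis
    by (intro group_action.intro group_hom.intro group_hom_axioms.intro group_BijGroup is_group)
qed

text \<open>Burnside's lemma: a pair of \<open>g\<close> and a commuting \<open>r\<close>-tuple fixed by \<open>g\<close> is a commuting
  \<open>(r + 1)\<close>-tuple.\<close>

lemma num_tuple_classes_mult_order:
  assumes fin: "finite (carrier G)"
  shows "num_tuple_classes G r * order G = card (commuting_tuples G (Suc r))"
proof -
  let ?T = "commuting_tuples G r"
  let ?S = "SIGMA g:carrier G. invariants ?T (diag_conj G r) g"
  have inv_iff: "x \<in> invariants ?T (diag_conj G r) g \<longleftrightarrow> x \<in> ?T \<and> (\<forall>i<r. g \<otimes> x i = x i \<otimes> g)"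
    if g: "g \<in> carrier G" for g x
  proof (cases "x \<in> ?T")
    case True
    then have c: "x i \<in> carrier G" if "i < r" for i
      using that by (auto simp: commuting_tuples_def)
    \<comment> \<open>Both tuples are \<open>undefined\<close> outside \<open>{..<r}\<close>, so
      only the coordinates below \<open>r\<close> matter.\<close>
    have "diag_conj G r g x = x \<longleftrightarrow> (\<forall>i<r. g \<otimes> x i \<otimes> inv g = x i)"
      using True by (auto simp: diag_conj_def fun_eq_iff commuting_tuples_def PiE_iff extensional_def
          restrict_def)
    then show ?thesis
      using True c g by (simp add: invariants_def conj_fixes_iff)
  qed (simp add: invariants_def)
  \<comment> \<open>The group element becomes the entry at position \<open>r\<close>, the first one
    at which \<open>x\<close> is \<open>undefined\<close>; restriction to \<open>{..<r}\<close>
    therefore recovers \<open>x\<close>.\<close>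
  have "bij_betw (\<lambda>(g, x). x(r := g)) ?S (commuting_tuples G (Suc r))"
  proof (rule bij_betw_byWitness[where f' = "\<lambda>y. (y r, restrict y {..<r})"])
    have "restrict (x(r := g)) {..<r} = x" if "g \<in> carrier G" "x \<in> invariants ?T (diag_conj G r) g" for g x
    proof (rule extensionalityI[where A = "{..<r}"])
      show "x \<in> extensional {..<r}"
        using that by (simp add: invariants_def commuting_tuples_def PiE_iff)
    qed auto
    then show "\<forall>p\<in>?S. (\<lambda>y. (y r, restrict y {..<r})) ((\<lambda>(g, x). x(r := g)) p) = p"
      by auto
    show "\<forall>y\<in>commuting_tuples G (Suc r). (\<lambda>(g, x). x(r := g)) (y r, restrict y {..<r}) = y"
      by (auto simp: commuting_tuples_def PiE_iff extensional_def fun_eq_iff)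
    show "(\<lambda>(g, x). x(r := g)) ` ?S \<subseteq> commuting_tuples G (Suc r)"
    proof clarify
      fix g x assume g: "g \<in> carrier G" and x: "x \<in> invariants ?T (diag_conj G r) g"
      then have "x \<in> ?T" "\<forall>i<r. g \<otimes> x i = x i \<otimes> g"
        by (simp_all add: inv_iff)
      then show "x(r := g) \<in> commuting_tuples G (Suc r)"
        using g by (auto simp: commuting_tuples_def PiE_iff extensional_def less_Suc_eq)
    qed
    show "(\<lambda>y. (y r, restrict y {..<r})) ` commuting_tuples G (Suc r) \<subseteq> ?S"
    proof (clarify, intro conjI)
      fix y assume y: "y \<in> commuting_tuples G (Suc r)"
      then show yr: "y r \<in> carrier G"
        by (auto simp: commuting_tuples_def)
      show "restrict y {..<r} \<in> invariants ?T (diag_conj G r) (y r)"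
        using y by (subst inv_iff[OF yr]) (auto simp: commuting_tuples_def)
    qed
  qed
  then have "card ?S = card (commuting_tuples G (Suc r))"
    by (rule bij_betw_same_card)
  moreover have "card ?S = (\<Sum>g\<in>carrier G. card (invariants ?T (diag_conj G r) g))"
    using fin finite_commuting_tuples[OF fin] by (subst card_SigmaI) (auto simp: invariants_def)
  moreover have "num_tuple_classes G r * order G =
      (\<Sum>g\<in>carrier G. card (invariants ?T (diag_conj G r) g))"
    unfolding num_tuple_classes_def
    by (rule group_action.burnside[OF diag_conj_action fin finite_commuting_tuples[OF fin]])
  ultimately show ?thesis
    by simp
qed

end

section \<open>Comparison of the two groups\<close>

theorem corollary4p22:
  fixes G :: "('a, 'm) monoid_scheme" and H :: "('b, 'n) monoid_scheme"
  assumes "group G" and "finite (carrier G)" and "\<not> comm_group G"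
    and "group H" and "finite (carrier H)" and "\<not> comm_group H"
  shows
    "(infinite {r. r \<ge> 2 \<and> commuting_prob G r = commuting_prob H r} \<longrightarrow>
        (\<forall>m\<ge>2. abelian_index_coeff G m = abelian_index_coeff H m) \<and>
        commuting_series G = commuting_series H \<and>
        abelian_index_spectrum G = abelian_index_spectrum H \<and>
        real (max_abelian_order G) / real (order G) =
          real (max_abelian_order H) / real (order H) \<and>
        num_max_abelian G = num_max_abelian H \<and>
        (order G = order H \<longrightarrow>
          max_abelian_order G = max_abelian_order H \<and>
          (\<forall>r\<ge>1. num_tuple_classes G r = num_tuple_classes H r))) \<and>
     ((\<exists>R. \<forall>r\<ge>R. commuting_prob G r = commuting_prob H r) \<longrightarrow>
        infinite {r. r \<ge> 2 \<and> commuting_prob G r = commuting_prob H r}) \<and>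
     ((\<forall>m\<ge>2. abelian_index_coeff G m = abelian_index_coeff H m) \<longleftrightarrow>
        commuting_series G = commuting_series H)"
proof -
  interpret G: group G by fact
  interpret H: group H by fact
  let ?c = abelian_index_coeff
  let ?E = "{r. r \<ge> 2 \<and> commuting_prob G r = commuting_prob H r}"
  define N where "N = max (order G) (order H)"
  have PG: "commuting_prob G r = (\<Sum>m\<in>{1..N}. real_of_int (?c G m) / real m ^ r)" for r
    by (rule G.commuting_prob_eq_sum) (use assms in \<open>auto simp: N_def\<close>)
  have PH: "commuting_prob H r = (\<Sum>m\<in>{1..N}. real_of_int (?c H m) / real m ^ r)" for r
    by (rule H.commuting_prob_eq_sum) (use assms in \<open>auto simp: N_def\<close>)
  \<comment> \<open>The indices 0 and 1 also carry coefficient 0, so agreement for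
    \<open>m \<ge> 2\<close> is agreement for all \<open>m\<close>.\<close>
  have zero: "?c G m = 0" "?c H m = 0" if "m < 2 \<or> m > N" for m
    using that G.abelian_index_coeff_eq_0[OF assms(2,3)] H.abelian_index_coeff_eq_0[OF assms(5,6)]
    by (auto simp: N_def)
  have coeff: "?c G m = ?c H m" if inf: "infinite ?E" for m
  proof (cases "m \<in> {1..N}")
    case True
    \<comment> \<open>Subtracting the two expansions turns each coincidence into a zero of one
      Dirichlet sum.\<close>
    have "?E \<subseteq> {r. (\<Sum>m\<in>{1..N}. (real_of_int (?c G m) - real_of_int (?c H m)) / real m ^ r) = 0}"
      by (auto simp: PG PH diff_divide_distrib sum_subtractf)
    then have "infinite {r. (\<Sum>m\<in>{1..N}. (real_of_int (?c G m) - real_of_int (?c H m)) / real m ^ r) = 0}"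
      using inf infinite_super by blast
    from finite_dirichlet_sum_unique[OF this True] show ?thesis
      by simp
  next
    case False
    then show ?thesis
      using zero[of m] by (cases "m = 0") auto
  qed
  have prob: "commuting_prob G r = commuting_prob H r" if "\<forall>m\<ge>2. ?c G m = ?c H m" for r
  proof -
    have "?c G m = ?c H m" for m
      using that zero[of m] by (cases "m \<ge> 2") auto
    then show ?thesis
      by (simp add: PG PH)
  qed
  have large: "infinite ?E" if "\<exists>R. \<forall>r\<ge>R. commuting_prob G r = commuting_prob H r"
  proof -
    from that obtain R where "\<forall>r\<ge>R. commuting_prob G r = commuting_prob H r" ..
    then have "{max R 2..} \<subseteq> ?E"
      by auto
    then show ?thesis
      using infinite_Ici infinite_super by blast
  qed
  have series: "commuting_series G = commuting_series H \<longleftrightarrow>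
      (\<forall>r\<ge>2. commuting_prob G r = commuting_prob H r)"
  proof
    assume "commuting_series G = commuting_series H"
    then have "commuting_prob G (n + 2) = commuting_prob H (n + 2)" for n
      by (metis commuting_series_def fps_nth_Abs_fps)
    then show "\<forall>r\<ge>2. commuting_prob G r = commuting_prob H r"
      by (metis le_add_diff_inverse2)
  qed (simp add: commuting_series_def)
  \<comment> \<open>Equal series mean agreement for all \<open>r \<ge> 2\<close>, hence for
    infinitely many \<open>r\<close>, so \<open>coeff\<close> applies; \<open>prob\<close> gives the
    converse.\<close>
  have equiv: "(\<forall>m\<ge>2. ?c G m = ?c H m) \<longleftrightarrow> commuting_series G = commuting_series H"
    using series prob coeff large by blast
  obtain k where k: "k * max_abelian_order G = order G" "k > 0"
      "?c G k = int (num_max_abelian G)" "num_max_abelian G > 0" "\<And>j. j < k \<Longrightarrow> ?c G j = 0"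
    using G.least_abelian_index[OF assms(2,3)] by blast
  obtain l where l: "l * max_abelian_order H = order H" "l > 0"
      "?c H l = int (num_max_abelian H)" "num_max_abelian H > 0" "\<And>j. j < l \<Longrightarrow> ?c H j = 0"
    using H.least_abelian_index[OF assms(5,6)] by blast
  have pos: "order G > 0" "order H > 0"
    using assms G.order_gt_0_iff_finite H.order_gt_0_iff_finite by auto
  have ratio: "real (max_abelian_order G) / real (order G) = 1 / real k"
      "real (max_abelian_order H) / real (order H) = 1 / real l"
    using pos k(1,2) l(1,2) by (auto simp: divide_simps mult.commute simp flip: of_nat_mult)
  have main: "(\<forall>m\<ge>2. ?c G m = ?c H m) \<and>
        commuting_series G = commuting_series H \<and>
        abelian_index_spectrum G = abelian_index_spectrum H \<and>
        real (max_abelian_order G) / real (order G) =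
          real (max_abelian_order H) / real (order H) \<and>
        num_max_abelian G = num_max_abelian H \<and>
        (order G = order H \<longrightarrow>
          max_abelian_order G = max_abelian_order H \<and>
          (\<forall>r\<ge>1. num_tuple_classes G r = num_tuple_classes H r))"
    if inf: "infinite ?E"
  proof (intro conjI impI)
    note c = coeff[OF inf]
    show c2: "\<forall>m\<ge>2. ?c G m = ?c H m"
      using c by simp
    then show "commuting_series G = commuting_series H"
      using equiv by blast
    show "abelian_index_spectrum G = abelian_index_spectrum H"
      by (simp add: abelian_index_spectrum_def c)
    \<comment> \<open>If \<open>k < l\<close>, the coefficient at \<open>k\<close> would be positive
      for \<open>G\<close> and zero for \<open>H\<close>; the case \<open>l < k\<close> is
      symmetric.\<close>
    have kl: "k = l"
      using k(3-5) l(3-5) c by (metis linorder_neqE_nat of_nat_0_eq_iff less_irrefl)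
    then show "real (max_abelian_order G) / real (order G) =
        real (max_abelian_order H) / real (order H)"
      by (simp add: ratio)
    show "num_max_abelian G = num_max_abelian H"
      using kl k(3) l(3) c by simp
    assume ord: "order G = order H"
    show "max_abelian_order G = max_abelian_order H"
      using kl k(1,2) l(1) ord by (metis mult_cancel1 less_irrefl)
    show "\<forall>r\<ge>1. num_tuple_classes G r = num_tuple_classes H r"
    proof (intro allI impI)
      fix r :: nat
      \<comment> \<open>Burnside expresses the classes of \<open>r\<close>-tuples through
        \<open>Suc r\<close>-tuples; with a common order the denominators cancel.\<close>
      have "card (commuting_tuples G (Suc r)) = card (commuting_tuples H (Suc r))"
        using prob[OF c2, of "Suc r"] pos ord by (simp add: commuting_prob_def)
      then have "num_tuple_classes G r * order G = num_tuple_classes H r * order H"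
        using G.num_tuple_classes_mult_order[OF assms(2)] H.num_tuple_classes_mult_order[OF assms(5)]
        by simp
      then show "num_tuple_classes G r = num_tuple_classes H r"
        using pos ord by simp
    qed
  qed
  show ?thesis
    using main large equiv by blast
qed

end
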